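(* Let $p$ and $q$ be relatively prime positive integers, and let $x\in\{0,1\}^{\mathbb Z}$ be a skew Sturmian sequence of frequency $\alpha=\frac{q}{p}$. Let $(a,b)$ be the restricted Bézout coefficients for $(q,p)$, i.e. the unique integers with $0\le a<q$, $0<b\le p$ and $bq-ap=1$. If $x$ is of type $S$, then $x$ is an eventually periodic sequence with least period $p+q$ and anomaly size $a+b$. If $x$ is of type $S'$, then $x$ is an eventually periodic sequence with least period $p+q$ and anomaly size $p+q-(a+b)$.
   Context: The alphabet is $\mathcal A=\{0,1\}$, and the shift on $\mathcal A^{\mathbb Z}$ is $\sigma(x)_i=x_{i+1}$. Sequences $x,y$ are similar if $\sigma^k(x)=y$ for some $k\in\mathbb Z$. A sequence $x$ is periodic if $\sigma^N(x)=x$ for some $N>0$; the least such $N$ is its least period. For integers $i\le j$, $x_{[i,j]}$ denotes the word $x_i\cdots x_j$; $|w|$ is the length of a word $w$. A non-periodic $x\in\mathcal A^{\mathbb Z}$ is eventually periodic if there are integers $i$ and $n>0$ such that, removing the word $v=x_{[i+1,i+n]}$ occurring at that position, the resulting sequence $p_v(x)$ defined by $p_v(x)_k=x_k$ for $k\le i$ and $p_v(x)_k=x_{k+n}$ for $k>i$ is periodic. Such a $v$ (together with its position) is called an anomaly word for $x$. The least period of $x$ is the least period of $p_v(x)$ (independent of the choice of $v$). The anomaly size of $x$ is $a(x)=\min\{|u|:u\text{ is an anomaly word for }x\}$. Cell-series: a sequence $x$ is written as a bi-infinite concatenation $\cdots B_{-1}B_0B_1\cdots$ where each cell $B_i$ is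 a word consisting of the symbol $1$ followed by a (possibly empty) string of $0$'s. An $n$-chain is a word of the form $B_r\cdots B_s$ with $n=s-r+1\ge 1$. The sequence $x$ is Sturmian if for every $m>0$ the numbers of $0$'s in any two $m$-chains of $x$ differ by at most one. If $b_n$ denotes the number of $0$'s in an $n$-chain, the limit $\lim_{n\to\infty}b_n/n$ exists and is called the frequency of $x$. A skew Sturmian sequence is a non-periodic Sturmian sequence with rational frequency. A cell-series determines a sequence up to similarity. Types: let $\alpha=q/p$ with $p$ and $q$ relatively prime positive integers, $\beta=1/\alpha=p/q$, $m\in\mathbb Z$, $G=\{m+k\beta:k\in\mathbb Z\}$. The cell-series $S(m,\alpha)$ is the one in which the number of $0$'s in $B_n$ is the number of points $z\in G$ with $n<z\le n+1$ if $n<m$, with $m<z<m+1$ if $n=m$, and with $n\le z<n+1$ if $n>m$. The cell-series $S'(m,\alpha)$ is the one in which the number of $0$'s in $B_n$ is the number of points $z\in G$ with $n\le z<n+1$ if $n<m$, with $m\le z\le m+1$ if $n=m$, and with $n<z\le n+1$ if $n>m$. A skew Sturmian sequence of frequency $\alpha$ is of type $S$ (respectively $S'$) if it has cell-series representation $S(m,\alpha)$ (respectively $S'(m,\alpha)$) for some $m\in\mathbb Z$. Up to similarity these do not depend on $m$. *)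

theory Defs
  imports Complex_Main
begin

section \<open>Periodic and eventually periodic sequences\<close>

definition shift :: "(int \<Rightarrow> 'a) \<Rightarrow> int \<Rightarrow> 'a" where
  "shift x = (\<lambda>i. x (i + 1))"

definition periodic :: "(int \<Rightarrow> 'a) \<Rightarrow> bool" where
  "periodic x \<longleftrightarrow> (\<exists>N>0. (shift ^^ N) x = x)"

definition least_period :: "(int \<Rightarrow> 'a) \<Rightarrow> nat" where
  "least_period x = (LEAST N. N > 0 \<and> (shift ^^ N) x = x)"

definition subword :: "(int \<Rightarrow> 'a) \<Rightarrow> int \<Rightarrow> int \<Rightarrow> 'a list" where
  "subword x i j = map x [i..j]"

text \<open>\<open>excise x i n\<close> deletes the \<open>n\<close> symbols at the positions \<open>i + 1, \<dots>, i + n\<close>.\<close>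

definition excise :: "(int \<Rightarrow> 'a) \<Rightarrow> int \<Rightarrow> nat \<Rightarrow> int \<Rightarrow> 'a" where
  "excise x i n = (\<lambda>k. if k \<le> i then x k else x (k + int n))"

definition anomaly_word :: "(int \<Rightarrow> 'a) \<Rightarrow> int \<Rightarrow> 'a list \<Rightarrow> bool" where
  "anomaly_word x i v \<longleftrightarrow>
     v \<noteq> [] \<and> v = subword x (i + 1) (i + int (length v)) \<and> periodic (excise x i (length v))"

definition eventually_periodic :: "(int \<Rightarrow> 'a) \<Rightarrow> bool" where
  "eventually_periodic x \<longleftrightarrow> \<not> periodic x \<and> (\<exists>i v. anomaly_word x i v)"

text \<open>The least period of an eventually periodic sequence; the definite description
  reflects that it does not depend on the anomaly word.\<close>

definition eventual_least_period :: "(int \<Rightarrow> 'a) \<Rightarrow> nat" where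
  "eventual_least_period x =
     (THE N. \<exists>i v. anomaly_word x i v \<and> N = least_period (excise x i (length v)))"

definition anomaly_size :: "(int \<Rightarrow> 'a) \<Rightarrow> nat" where
  "anomaly_size x = (LEAST n. \<exists>i v. anomaly_word x i v \<and> n = length v)"

section \<open>Cell-series\<close>

definition cell :: "nat \<Rightarrow> nat list" where
  "cell k = 1 # replicate k 0"

text \<open>\<open>x\<close> is the bi-infinite concatenation of the cells \<open>B n\<close>, where \<open>s n\<close> is the
  position at which \<open>B n\<close> starts. The position \<open>s 0\<close> is arbitrary, so that a cell-series
  determines a sequence only up to similarity.\<close>

definition has_cell_series :: "(int \<Rightarrow> nat) \<Rightarrow> (int \<Rightarrow> nat list) \<Rightarrow> bool" where
  "has_cell_series x B \<longleftrightarrow>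
     (\<forall>n. B n \<in> range cell) \<and>
     (\<exists>s :: int \<Rightarrow> int. \<forall>n. s (n + 1) = s n + int (length (B n)) \<and>
                           subword x (s n) (s (n + 1) - 1) = B n)"

definition chain :: "(int \<Rightarrow> nat list) \<Rightarrow> int \<Rightarrow> nat \<Rightarrow> nat list" where
  "chain B r n = concat (map B [r..r + int n - 1])"

definition zeros :: "nat list \<Rightarrow> nat" where
  "zeros w = count_list w 0"

text \<open>The cells of a sequence are determined up to an index shift, hence the choice of \<open>B\<close>
  in the following two definitions is irrelevant.\<close>

definition sturmian :: "(int \<Rightarrow> nat) \<Rightarrow> bool" where
  "sturmian x \<longleftrightarrow> (\<exists>B. has_cell_series x B \<and>
     (\<forall>m>0. \<forall>r r'. \<bar>int (zeros (chain B r m)) - int (zeros (chain B r' m))\<bar> \<le> 1))"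

text \<open>The limit is required for every choice \<open>r\<close> of one \<open>n\<close>-chain for each \<open>n\<close>.\<close>

definition has_frequency :: "(int \<Rightarrow> nat) \<Rightarrow> real \<Rightarrow> bool" where
  "has_frequency x \<alpha> \<longleftrightarrow> (\<exists>B. has_cell_series x B \<and>
     (\<forall>r :: nat \<Rightarrow> int. (\<lambda>n. real (zeros (chain B (r n) n)) / real n) \<longlonglongrightarrow> \<alpha>))"

definition skew_sturmian :: "(int \<Rightarrow> nat) \<Rightarrow> bool" where
  "skew_sturmian x \<longleftrightarrow> \<not> periodic x \<and> sturmian x \<and> (\<exists>\<alpha>\<in>\<rat>. has_frequency x \<alpha>)"

section \<open>The two types of skew Sturmian sequences\<close>

definition G :: "int \<Rightarrow> real \<Rightarrow> real set" where
  "G m \<alpha> = {real_of_int m + real_of_int k * (1 / \<alpha>) | k :: int. True}"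

definition S_series :: "int \<Rightarrow> real \<Rightarrow> int \<Rightarrow> nat list" where
  "S_series m \<alpha> n = cell (card
     (if n < m then {z \<in> G m \<alpha>. of_int n < z \<and> z \<le> of_int n + 1}
      else if n = m then {z \<in> G m \<alpha>. of_int m < z \<and> z < of_int m + 1}
      else {z \<in> G m \<alpha>. of_int n \<le> z \<and> z < of_int n + 1}))"

definition S'_series :: "int \<Rightarrow> real \<Rightarrow> int \<Rightarrow> nat list" where
  "S'_series m \<alpha> n = cell (card
     (if n < m then {z \<in> G m \<alpha>. of_int n \<le> z \<and> z < of_int n + 1}
      else if n = m then {z \<in> G m \<alpha>. of_int m \<le> z \<and> z \<le> of_int m + 1}
      else {z \<in> G m \<alpha>. of_int n < z \<and> z \<le> of_int n + 1}))"

definition type_S :: "(int \<Rightarrow> nat) \<Rightarrow> real \<Rightarrow> bool" where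
  "type_S x \<alpha> \<longleftrightarrow> (\<exists>m. has_cell_series x (S_series m \<alpha>))"

definition type_S' :: "(int \<Rightarrow> nat) \<Rightarrow> real \<Rightarrow> bool" where
  "type_S' x \<alpha> \<longleftrightarrow> (\<exists>m. has_cell_series x (S'_series m \<alpha>))"

end

theory Submission
  imports Defs
begin

text \<open>Put \<open>P = p + q\<close> and \<open>c = a + b\<close>. Up to similarity, the cells of the two series start at the
  positions \<open>\<lfloor>(N P - \<delta>) / p\<rfloor>\<close>, where \<open>\<delta>\<close> takes one of the values \<open>0\<close>, \<open>1\<close> for
  \<open>N \<le> 0\<close> and the other one for \<open>N > 0\<close>. For constant \<open>\<delta>\<close> these positions describe a periodic
  sequence of least period \<open>P\<close>, and since \<open>b P - c p = 1\<close>, passing from \<open>\<delta> = 0\<close> to \<open>\<delta> = 1\<close>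
  is a translation by \<open>c\<close>. So \<open>x\<close> is a periodic sequence on a left half-line, followed by its
  translate by \<open>c\<close> (type \<open>S\<close>) or by \<open>P - c\<close> (type \<open>S'\<close>). Deleting \<open>n\<close> symbols leaves a periodic
  sequence only if the two phases match, that is, if \<open>n\<close> is congruent to this translation
  modulo \<open>P\<close>.\<close>

section \<open>Periodic sequences with a phase change\<close>

lemma shift_funpow: "(shift ^^ N) x = (\<lambda>i. x (i + int N))"
  by (induction N) (auto simp: shift_def algebra_simps)

lemma periodic_mult:
  fixes A :: "int \<Rightarrow> 'a"
  assumes per: "\<And>i. A (i + N) = A i"
  shows "A (i + j * N) = A i"
proof (induction j arbitrary: i rule: int_induct[where k = 0])
  case base
  show ?case by simp
next
  case (step1 j)
  then show ?case using per[of "i + j * N"] by (simp add: algebra_simps)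
next
  case (step2 j)
  then show ?case using per[of "i + j * N - N"] by (simp add: algebra_simps)
qed

text \<open>\<open>M * N\<close> is a common period of both sequences, and subtracting a large
  multiple of it moves any position into the half-line of agreement.\<close>

lemma agree_left_half_line:
  fixes A B :: "int \<Rightarrow> 'a"
  assumes A: "\<And>i. A (i + M) = A i" and B: "\<And>i. B (i + N) = B i"
    and pos: "M > 0" "N > 0" and agree: "\<And>i. i \<le> t \<Longrightarrow> A i = B i"
  shows "A = B"
proof
  fix k
  define j where "j = \<bar>k\<bar> + \<bar>t\<bar>"
  have "j * 1 \<le> j * (M * N)"
    using pos by (intro mult_left_mono) (auto simp: j_def int_one_le_iff_zero_less)
  then have le: "k - j * (M * N) \<le> t"
    by (simp add: j_def)
  have "A k = A (k - j * (M * N))"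
    using periodic_mult[of A M k "- (j * N)"] A by (simp add: algebra_simps)
  also have "\<dots> = B (k - j * (M * N))"
    by (rule agree[OF le])
  also have "\<dots> = B k"
    using periodic_mult[of B N k "- (j * M)"] B by (simp add: algebra_simps)
  finally show "A k = B k" .
qed

text \<open>Deleting the \<open>c\<close> symbols after \<open>t\<close> lines up the two phases and
  leaves \<open>A\<close>. Conversely, a periodic excision coincides with \<open>A\<close> far to
  the left, hence everywhere, and comparing the two far to the right makes \<open>n - c\<close> a
  period of \<open>A\<close>. As \<open>0 < c < P\<close>, no natural number below \<open>c\<close>
  is congruent to \<open>c\<close> modulo \<open>P\<close>.\<close>

lemma phase_change:
  fixes A x :: "int \<Rightarrow> 'a" and P c t :: int
  assumes per: "\<And>N. (\<forall>i. A (i + N) = A i) \<longleftrightarrow> P dvd N"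
    and c: "0 < c" "c < P"
    and x: "\<And>i. x i = (if i \<le> t then A i else A (i - c))"
    and np: "\<not> periodic x"
  shows "eventually_periodic x \<and> int (eventual_least_period x) = P \<and> int (anomaly_size x) = c"
proof -
  have PA: "A (i + P) = A i" for i
    using per[of P] by simp
  have excise_eq: "excise x i n = A \<and> P dvd int n - c" if pe: "periodic (excise x i n)" for i n
  proof -
    define y where "y = excise x i n"
    obtain N where N: "N > 0" "\<And>k. y (k + int N) = y k"
      using pe unfolding periodic_def shift_funpow y_def by metis
    have yA: "y = A"
    proof (rule agree_left_half_line[where M = "int N" and N = P and t = "min i t"])
      show "y k = A k" if "k \<le> min i t" for k
        using that by (simp add: y_def excise_def x)
    qed (use N PA c in auto)
    have right: "A (k + (int n - c)) = A k" if "k > max i t" for k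
      using that fun_cong[OF yA, of k] by (simp add: y_def excise_def x algebra_simps)
    \<comment> \<open>Reflection carries the right half-line to a left one, where the same
      uniqueness argument applies.\<close>
    have "(\<lambda>k. A (- k + (int n - c))) = (\<lambda>k. A (- k))"
    proof (rule agree_left_half_line[where M = P and N = P and t = "- max i t - 1"])
      show "A (- (k + P) + (int n - c)) = A (- k + (int n - c))" for k
        using PA[of "- (k + P) + (int n - c)"] by (simp add: algebra_simps)
      show "A (- (k + P)) = A (- k)" for k
        using PA[of "- (k + P)"] by simp
      show "A (- k + (int n - c)) = A (- k)" if "k \<le> - max i t - 1" for k
        using that by (intro right) linarith
    qed (use c in auto)
    then have "A (k + (int n - c)) = A k" for k
      by (metis minus_minus)
    with per yA show ?thesis
      by (auto simp: y_def)
  qed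
  have lpA: "least_period A = nat P"
    unfolding least_period_def shift_funpow
  proof (rule Least_equality)
    show "0 < nat P \<and> (\<lambda>i. A (i + int (nat P))) = A"
      using PA c by auto
    show "nat P \<le> N" if "0 < N \<and> (\<lambda>i. A (i + int N)) = A" for N
    proof -
      have "P dvd int N" using that per by metis
      then show ?thesis using that zdvd_imp_le by fastforce
    qed
  qed
  have perA: "periodic A"
    unfolding periodic_def shift_funpow using PA c by (intro exI[of _ "nat P"]) auto
  define w where "w = subword x (t + 1) (t + c)"
  have len: "length w = nat c"
    by (simp add: w_def subword_def)
  have "excise x t (nat c) = A"
    using c by (auto simp: excise_def x)
  then have w: "anomaly_word x t w"
    unfolding anomaly_word_def using perA len c by (auto simp: w_def)
  \<comment> \<open>Every periodic excision equals \<open>A\<close>, so the definite description is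
    well defined.\<close>
  have "eventual_least_period x = nat P"
    unfolding eventual_least_period_def
  proof (rule the_equality)
    show "\<exists>i v. anomaly_word x i v \<and> nat P = least_period (excise x i (length v))"
      using w excise_eq lpA unfolding anomaly_word_def by metis
    show "N = nat P"
      if "\<exists>i v. anomaly_word x i v \<and> N = least_period (excise x i (length v))" for N
      using that excise_eq lpA unfolding anomaly_word_def by metis
  qed
  moreover have "anomaly_size x = nat c"
    unfolding anomaly_size_def
  proof (rule Least_equality)
    show "\<exists>i v. anomaly_word x i v \<and> nat c = length v"
      using w len by metis
    show "nat c \<le> n" if "\<exists>i v. anomaly_word x i v \<and> n = length v" for n
    proof -
      have dvd: "P dvd int n - c"
        using that excise_eq unfolding anomaly_word_def by blast
      have False if "int n < c"
      proof -
        have "P dvd c - int n" using dvd by (simp add: dvd_diff_commute)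
        with that have "P \<le> c - int n" by (intro zdvd_imp_le) auto
        with c show False by simp
      qed
      then show ?thesis by force
    qed
  qed
  ultimately show ?thesis
    using w np c unfolding eventually_periodic_def by auto
qed

section \<open>Cell boundaries\<close>

text \<open>Induct upwards and downwards from \<open>s 0\<close>: when \<open>i\<close> moves by
  one, the index of its block moves by at most one.\<close>

lemma strict_increasing_cover:
  fixes s :: "int \<Rightarrow> int"
  assumes inc: "\<And>n. s n < s (n + 1)"
  shows "\<exists>n. s n \<le> i \<and> i < s (n + 1)"
proof (induction i rule: int_induct[where k = "s 0"])
  case base
  show ?case using inc[of 0] by auto
next
  case (step1 i)
  then obtain n where "s n \<le> i" "i < s (n + 1)" by auto
  then show ?case
    using inc[of "n + 1"] by (cases "i + 1 = s (n + 1)") (auto intro: exI[of _ n] exI[of _ "n + 1"])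
next
  case (step2 i)
  then obtain n where n: "s n \<le> i" "i < s (n + 1)" by auto
  show ?case
  proof (cases "i = s n")
    case True
    then show ?thesis using inc[of "n - 1"] by (intro exI[of _ "n - 1"]) auto
  qed (use n in \<open>auto intro!: exI[of _ n]\<close>)
qed

lemma subword_eq_cell:
  assumes "subword x i j = cell k"
  shows "x i = 1" and "\<And>l. i < l \<Longrightarrow> l \<le> j \<Longrightarrow> x l = 0"
proof -
  have ij: "i \<le> j"
    using assms by (cases "i \<le> j") (auto simp: subword_def cell_def)
  then have eq: "x i # map x [i + 1..j] = 1 # replicate k 0"
    using assms by (simp add: subword_def cell_def upto_rec1)
  then show "x i = 1" by simp
  show "x l = 0" if "i < l" "l \<le> j" for l
  proof -
    have "x l \<in> set (map x [i + 1..j])" using that by simp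
    also have "map x [i + 1..j] = replicate k 0" using eq by simp
    finally show ?thesis by simp
  qed
qed

text \<open>\<open>g\<close> plays the role of partial sums of the zero counts: each cell
  contributes a single \<open>1\<close> and \<open>g (n + 1) - g n\<close> zeros, so cell
  \<open>n\<close> starts at \<open>t + n + g n\<close>. The unknown \<open>t\<close> reflects the
  free choice of \<open>s 0\<close>.\<close>

lemma has_cell_series_ones:
  assumes x: "has_cell_series x B" and B: "\<And>n. B n = cell (nat (g (n + 1) - g n))"
    and mono: "\<And>n. g n \<le> g (n + 1)"
  obtains t where "\<And>i. x i = of_bool (\<exists>n. i = t + n + g n)"
proof -
  obtain s where s: "\<And>n. s (n + 1) = s n + int (length (B n))"
      "\<And>n. subword x (s n) (s (n + 1) - 1) = B n"
    using x unfolding has_cell_series_def by blast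
  \<comment> \<open>Monotonicity of \<open>g\<close> keeps \<open>nat\<close> from
    truncating.\<close>
  have step: "s (n + 1) = s n + 1 + (g (n + 1) - g n)" for n
    using s(1)[of n] mono[of n] by (simp add: B cell_def)
  define t where "t = s 0 - g 0"
  have sn: "s n = t + n + g n" for n
  proof (induction n rule: int_induct[where k = 0])
    case (step2 n)
    then show ?case using step[of "n - 1"] by simp
  qed (auto simp: t_def step)
  have "x i = of_bool (\<exists>n. i = s n)" for i
  proof -
    have lt: "s k < s (k + 1)" for k
      using step[of k] mono[of k] by simp
    obtain n where n: "s n \<le> i" "i < s (n + 1)"
      using strict_increasing_cover[of s, OF lt] by blast
    have cell: "subword x (s n) (s (n + 1) - 1) = cell (nat (g (n + 1) - g n))"
      using s(2) B by simp
    have smono: "s k \<le> s l" if "k \<le> l" for k l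
      using that
    proof (induction l rule: int_ge_induct)
      case (step l)
      then show ?case using lt[of l] by linarith
    qed simp
    have "i = s n" if "i = s k" for k
      using smono[of k n] smono[of "n + 1" k] n that by (cases "k \<le> n") auto
    then show ?thesis
      using subword_eq_cell[OF cell] n by (cases "i = s n") auto
  qed
  then show ?thesis
    using that[of t] sn by simp
qed

section \<open>Counting the points of \<open>G\<close> in an interval\<close>

text \<open>Multiplying by \<open>q\<close> turns the condition \<open>m + u / q < z \<le> m + v / q\<close> on
  \<open>z = m + k / \<alpha> = m + k p / q\<close> into the integer condition \<open>u < k p \<le> v\<close>; the other kinds of
  intervals have this form, too, because \<open>u \<le> k p\<close> iff \<open>u - 1 < k p\<close>.\<close>

lemma card_G:
  fixes p q m u v :: int
  assumes pq: "p > 0" "q > 0"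
    and I: "\<And>k. I (real_of_int m + real_of_int (k * p) / real_of_int q) \<longleftrightarrow> u < k * p \<and> k * p \<le> v"
  shows "card {z \<in> G m (real_of_int q / real_of_int p). I z} = nat (v div p - u div p)"
proof -
  let ?z = "\<lambda>k :: int. real_of_int m + real_of_int (k * p) / real_of_int q"
  \<comment> \<open>The adjunction between floor division and multiplication by \<open>p\<close>
    turns bounds on \<open>k * p\<close> into bounds on \<open>k\<close>.\<close>
  have le: "k \<le> w div p \<longleftrightarrow> k * p \<le> w" for k w
  proof
    assume "k \<le> w div p"
    then have "k * p \<le> w div p * p" using pq by (intro mult_right_mono) auto
    also have "\<dots> \<le> w" using pq minus_mod_eq_div_mult[of w p] pos_mod_sign[of p w] by linarith
    finally show "k * p \<le> w" .
  next
    assume "k * p \<le> w"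
    then have "k * p div p \<le> w div p" using pq by (intro zdiv_mono1) auto
    then show "k \<le> w div p" using pq by simp
  qed
  have k: "u < k * p \<and> k * p \<le> v \<longleftrightarrow> k \<in> {u div p<..v div p}" for k
    using le[of k u] le[of k v] by auto
  have "{z \<in> G m (real_of_int q / real_of_int p). I z} = ?z ` {k. I (?z k)}"
    by (auto simp: G_def)
  also have "{k. I (?z k)} = {u div p<..v div p}"
    by (intro set_eqI) (simp only: mem_Collect_eq I k)
  also have "card (?z ` {u div p<..v div p}) = card {u div p<..v div p}"
    using pq by (intro card_image inj_onI) simp
  finally show ?thesis by simp
qed

lemma G_point_iff:
  fixes p q m n k :: int
  assumes "q > 0"
  shows "of_int n < real_of_int m + real_of_int (k * p) / real_of_int q \<longleftrightarrow> (n - m) * q < k * p"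
    and "of_int n \<le> real_of_int m + real_of_int (k * p) / real_of_int q \<longleftrightarrow> (n - m) * q - 1 < k * p"
    and "real_of_int m + real_of_int (k * p) / real_of_int q \<le> of_int n + 1
           \<longleftrightarrow> k * p \<le> (n + 1 - m) * q"
    and "real_of_int m + real_of_int (k * p) / real_of_int q < of_int n + 1
           \<longleftrightarrow> k * p \<le> (n + 1 - m) * q - 1"
proof -
  define y where "y = real_of_int (k * p) / real_of_int q"
  have y: "real_of_int q * y = real_of_int (k * p)"
    using assms by (simp add: y_def)
  have less: "of_int c < y \<longleftrightarrow> c * q < k * p" "y < of_int c \<longleftrightarrow> k * p < c * q" for c
    using assms unfolding y_def
    by (simp_all add: pos_less_divide_eq pos_divide_less_eq flip: of_int_mult)
  show "of_int n < real_of_int m + real_of_int (k * p) / real_of_int q \<longleftrightarrow> (n - m) * q < k * p"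
    using less(1)[of "n - m"] unfolding y_def[symmetric] by (simp add: algebra_simps)
  show "of_int n \<le> real_of_int m + real_of_int (k * p) / real_of_int q \<longleftrightarrow> (n - m) * q - 1 < k * p"
    using less(2)[of "n - m"] unfolding y_def[symmetric] by (simp add: algebra_simps) linarith
  show "real_of_int m + real_of_int (k * p) / real_of_int q \<le> of_int n + 1
           \<longleftrightarrow> k * p \<le> (n + 1 - m) * q"
    using less(1)[of "n + 1 - m"] unfolding y_def[symmetric] by (simp add: algebra_simps) linarith
  show "real_of_int m + real_of_int (k * p) / real_of_int q < of_int n + 1
           \<longleftrightarrow> k * p \<le> (n + 1 - m) * q - 1"
    using less(2)[of "n + 1 - m"] unfolding y_def[symmetric] by (simp add: algebra_simps) linarith
qed

text \<open>Partial sums of the zero counts, up to a constant, with \<open>N\<close> the cell index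
  relative to \<open>m\<close>. Offset \<open>0\<close> gives a point of \<open>G\<close> on a
  border to the cell on its left, offset \<open>1\<close> to the cell on its right. The switch
  between \<open>N = 0\<close> and \<open>N = 1\<close> makes the interval of cell \<open>m\<close>
  open (from \<open>0\<close> to \<open>1\<close>) or closed (from \<open>1\<close> to
  \<open>0\<close>).\<close>

definition boundary :: "int \<Rightarrow> int \<Rightarrow> int \<Rightarrow> int \<Rightarrow> int \<Rightarrow> int" where
  "boundary p q \<delta> \<epsilon> N = (N * q - (if N \<le> 0 then \<delta> else \<epsilon>)) div p"

text \<open>Even where the offset rises by one, the gain \<open>q \<ge> 1\<close> in the numerator
  makes up for it.\<close>

lemma boundary_mono:
  assumes "p > 0" "q > 0" "\<delta> \<in> {0, 1}" "\<epsilon> \<in> {0, 1}"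
  shows "boundary p q \<delta> \<epsilon> N \<le> boundary p q \<delta> \<epsilon> (N + 1)"
proof -
  have "(N + 1) * q = N * q + q" by (simp add: algebra_simps)
  then show ?thesis
    unfolding boundary_def using assms by (intro zdiv_mono1) auto
qed

lemma S_series_eq:
  assumes "p > 0" "q > 0"
  shows "S_series m (real_of_int q / real_of_int p) n =
    cell (nat (boundary p q 0 1 (n + 1 - m) - boundary p q 0 1 (n - m)))"
proof (cases n m rule: linorder_cases)
  case less
  then show ?thesis
    using card_G[OF assms, where I = "(\<lambda>z. of_int n < z \<and> z \<le> of_int n + 1)" and m = m
        and u = "(n - m) * q" and v = "(n + 1 - m) * q", OF conj_cong[OF G_point_iff(1)[OF assms(2)]
          G_point_iff(3)[OF assms(2)]]]
    by (simp add: S_series_def boundary_def)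
next
  case equal
  then show ?thesis
    using card_G[OF assms, where I = "(\<lambda>z. of_int m < z \<and> z < of_int m + 1)" and m = m
        and u = "(m - m) * q" and v = "(m + 1 - m) * q - 1", OF conj_cong[OF G_point_iff(1)[OF assms(2)]
          G_point_iff(4)[OF assms(2)]]]
    by (simp add: S_series_def boundary_def)
next
  case greater
  then show ?thesis
    using card_G[OF assms, where I = "(\<lambda>z. of_int n \<le> z \<and> z < of_int n + 1)" and m = m
        and u = "(n - m) * q - 1" and v = "(n + 1 - m) * q - 1", OF conj_cong[OF G_point_iff(2)[OF assms(2)]
          G_point_iff(4)[OF assms(2)]]]
    by (simp add: S_series_def boundary_def)
qed

lemma S'_series_eq:
  assumes "p > 0" "q > 0"
  shows "S'_series m (real_of_int q / real_of_int p) n =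
    cell (nat (boundary p q 1 0 (n + 1 - m) - boundary p q 1 0 (n - m)))"
proof (cases n m rule: linorder_cases)
  case less
  then show ?thesis
    using card_G[OF assms, where I = "(\<lambda>z. of_int n \<le> z \<and> z < of_int n + 1)" and m = m
        and u = "(n - m) * q - 1" and v = "(n + 1 - m) * q - 1", OF conj_cong[OF G_point_iff(2)[OF assms(2)]
          G_point_iff(4)[OF assms(2)]]]
    by (simp add: S'_series_def boundary_def)
next
  case equal
  then show ?thesis
    using card_G[OF assms, where I = "(\<lambda>z. of_int m \<le> z \<and> z \<le> of_int m + 1)" and m = m
        and u = "(m - m) * q - 1" and v = "(m + 1 - m) * q", OF conj_cong[OF G_point_iff(2)[OF assms(2)]
          G_point_iff(3)[OF assms(2)]]]
    by (simp add: S'_series_def boundary_def)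
next
  case greater
  then show ?thesis
    using card_G[OF assms, where I = "(\<lambda>z. of_int n < z \<and> z \<le> of_int n + 1)" and m = m
        and u = "(n - m) * q" and v = "(n + 1 - m) * q", OF conj_cong[OF G_point_iff(1)[OF assms(2)]
          G_point_iff(3)[OF assms(2)]]]
    by (simp add: S'_series_def boundary_def)
qed

section \<open>The periodic sequences with constant offset\<close>

text \<open>For coprime \<open>0 < p < P\<close>, this is the bi-infinite repetition of a
  Christoffel word of length \<open>P\<close> with \<open>p\<close> ones; \<delta> selects the
  phase.\<close>

definition christoffel :: "int \<Rightarrow> int \<Rightarrow> int \<Rightarrow> int \<Rightarrow> nat" where
  "christoffel p P \<delta> i = of_bool (\<exists>N. (N * P - \<delta>) div p = i)"

lemma div_eq_iff_between:
  fixes p u i :: int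
  assumes "p > 0"
  shows "u div p = i \<longleftrightarrow> i * p \<le> u \<and> u < i * p + p"
proof
  assume "u div p = i"
  then have "u - u mod p = i * p"
    by (simp add: minus_mod_eq_div_mult)
  then show "i * p \<le> u \<and> u < i * p + p"
    using pos_mod_bound[OF assms, of u] pos_mod_sign[OF assms, of u] by linarith
next
  assume "i * p \<le> u \<and> u < i * p + p"
  then show "u div p = i"
    using assms by (intro int_div_pos_eq[of u p i "u - i * p"]) (auto simp: algebra_simps)
qed

text \<open>The residue is the distance from \<open>i * p + \<delta>\<close> to the next multiple of
  \<open>P\<close>, which must fall into a window of length \<open>p\<close>. The sequence thus
  codes the rotation by \<open>- p\<close> modulo \<open>P\<close> with respect to the arc
  \<open>[0, p)\<close>.\<close>

lemma christoffel_mod: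
  assumes "0 < p" "p < P"
  shows "christoffel p P \<delta> i = of_bool ((- (i * p) - \<delta>) mod P < p)"
proof -
  have "(\<exists>N. (N * P - \<delta>) div p = i) \<longleftrightarrow> (- (i * p) - \<delta>) mod P < p"
  proof
    assume "\<exists>N. (N * P - \<delta>) div p = i"
    then obtain N where N: "0 \<le> N * P - \<delta> - i * p" "N * P - \<delta> - i * p < p"
      using assms by (auto simp: div_eq_iff_between)
    have "(- (i * p) - \<delta>) mod P = (- (i * p) - \<delta> + N * P) mod P" by simp
    also have "\<dots> = N * P - \<delta> - i * p"
      using N assms by (simp add: algebra_simps mod_pos_pos_trivial)
    finally show "(- (i * p) - \<delta>) mod P < p" using N by simp
  next
    assume *: "(- (i * p) - \<delta>) mod P < p"
    let ?u = "- (i * p) - \<delta>"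
    have "?u mod P = ?u - (?u div P) * P" "0 \<le> ?u mod P"
      using assms by (auto simp: minus_div_mult_eq_mod)
    with * show "\<exists>N. (N * P - \<delta>) div p = i"
      using assms by (intro exI[of _ "- (?u div P)"]) (auto simp: div_eq_iff_between)
  qed
  then show ?thesis by (simp add: christoffel_def)
qed

text \<open>Since \<open>c * p \<equiv> -1\<close> modulo \<open>P\<close>, moving by
  \<open>c\<close> positions changes the residue by one.\<close>

lemma christoffel_translate:
  assumes "0 < p" "p < P" "b * P - c * p = 1"
  shows "christoffel p P 0 (i - c) = christoffel p P 1 i"
proof -
  have "(- ((i - c) * p) - 0) = (- (i * p) - 1) + b * P"
    using assms(3) by (simp add: algebra_simps)
  then show ?thesis
    using assms by (simp only: christoffel_mod mod_mult_self1)
qed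

text \<open>A period \<open>N\<close> rotates the arc \<open>[0, p)\<close> modulo \<open>P\<close>
  onto itself. A proper arc is preserved only by the trivial rotation, so
  \<open>P dvd N * p\<close>, and coprimality finishes.\<close>

lemma christoffel_period_iff:
  assumes pP: "0 < p" "p < P" and bc: "b * P - c * p = 1"
  shows "(\<forall>i. christoffel p P \<delta> (i + N) = christoffel p P \<delta> i) \<longleftrightarrow> P dvd N"
proof
  assume "P dvd N"
  then obtain k where N: "N = P * k" ..
  have "- ((i + N) * p) - \<delta> = (- (i * p) - \<delta>) + (- k * p) * P" for i
    by (simp add: N algebra_simps)
  then show "\<forall>i. christoffel p P \<delta> (i + N) = christoffel p P \<delta> i"
    using pP by (simp only: christoffel_mod mod_mult_self1) simp
next
  assume *: "\<forall>i. christoffel p P \<delta> (i + N) = christoffel p P \<delta> i"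
  define u where "u = (- (N * p)) mod P"
  have inv: "(v + u) mod P < p \<longleftrightarrow> v mod P < p" for v
  proof -
    \<comment> \<open>Because \<open>c * p \<equiv> -1\<close>, position
      \<open>c * (v + \<delta>)\<close> has residue \<open>v\<close>; so every residue is
      reached.\<close>
    have e: "- (c * (v + \<delta>) * p) - \<delta> = v + (- b * (v + \<delta>)) * P"
    proof -
      have "c * p = b * P - 1" using bc by simp
      then have "c * (v + \<delta>) * p = (b * P - 1) * (v + \<delta>)"
        by (metis mult.commute mult.left_commute)
      then show ?thesis by (simp add: algebra_simps)
    qed
    have e': "- ((c * (v + \<delta>) + N) * p) - \<delta> = (v - N * p) + (- b * (v + \<delta>)) * P"
      using e by (simp add: algebra_simps)
    have "christoffel p P \<delta> (c * (v + \<delta>) + N) = christoffel p P \<delta> (c * (v + \<delta>))"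
      using * by blast
    then have "(v - N * p) mod P < p \<longleftrightarrow> v mod P < p"
      using pP by (simp only: christoffel_mod e e' mod_mult_self1 of_bool_eq_iff)
    moreover have "(v + u) mod P = (v - N * p) mod P"
      unfolding u_def by (simp add: mod_simps)
    ultimately show ?thesis by simp
  qed
  have u: "0 \<le> u" "u < P"
    using pP by (auto simp: u_def)
  \<comment> \<open>Residue \<open>0\<close> lies in the arc and \<open>-1\<close> does not, so
    \<open>u\<close> lies in it and \<open>u - 1\<close> does not. Only \<open>u = 0\<close>
    remains.\<close>
  have "u < p"
    using inv[of 0] u pP by simp
  have "u = 0"
  proof (rule ccontr)
    assume "u \<noteq> 0"
    have "(- 1) mod P = P - 1"
      using pP by (simp add: zmod_minus1)
    then have "\<not> (u - 1) mod P < p"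
      using inv[of "- 1"] pP by simp
    moreover have "(u - 1) mod P = u - 1"
      using u \<open>u \<noteq> 0\<close> by (intro mod_pos_pos_trivial) auto
    ultimately show False using \<open>u < p\<close> by simp
  qed
  then have "P dvd N * p"
    unfolding u_def by (simp add: dvd_eq_mod_eq_0[symmetric])
  moreover have "coprime P p"
  proof (rule coprimeI)
    fix d assume "d dvd P" "d dvd p"
    then have "d dvd b * P - c * p" by simp
    then show "is_unit d" by (simp add: bc)
  qed
  ultimately show "P dvd N"
    by (simp add: coprime_dvd_mult_left_iff)
qed

section \<open>From cell series to a change of offset\<close>

text \<open>The case distinction in \<open>boundary\<close> is on the cell index, but it amounts to one on the
  position: cells with index \<open>N \<le> 0\<close> start at positions \<open>\<le> 0\<close>, the others at positions \<open>> 0\<close>.\<close>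

lemma boundary_christoffel:
  assumes "p > 0" "q > 0" "\<delta> \<in> {0, 1}" "\<epsilon> \<in> {0, 1}"
  shows "of_bool (\<exists>N. i = N + boundary p q \<delta> \<epsilon> N) =
    (if i \<le> 0 then christoffel p (p + q) \<delta> i else christoffel p (p + q) \<epsilon> i)"
proof -
  define f where "f \<gamma> N = (N * (p + q) - \<gamma>) div p" for \<gamma> N
  have f: "N + boundary p q \<delta> \<epsilon> N = (if N \<le> 0 then f \<delta> N else f \<epsilon> N)" for N
  proof -
    have "N * (p + q) - \<gamma> = (N * q - \<gamma>) + N * p" for \<gamma>
      by (simp add: algebra_simps)
    then have "f \<gamma> N = N + (N * q - \<gamma>) div p" for \<gamma>
      using assms by (simp only: f_def div_mult_self1)
    then show ?thesis by (simp add: boundary_def)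
  qed
  have neg: "f \<gamma> N \<le> 0" if "N \<le> 0" "\<gamma> \<in> {0, 1}" for \<gamma> N
  proof -
    have "N * (p + q) \<le> 0" using that assms by (intro mult_nonpos_nonneg) auto
    then have "f \<gamma> N \<le> 0 div p" unfolding f_def using that assms by (intro zdiv_mono1) auto
    then show ?thesis by simp
  qed
  \<comment> \<open>Even with offset \<open>1\<close> the numerator is at least
    \<open>p + q - 1 \<ge> p\<close>.\<close>
  have pos: "f \<gamma> N > 0" if "\<not> N \<le> 0" "\<gamma> \<in> {0, 1}" for \<gamma> N
  proof -
    have "p + q \<le> N * (p + q)"
      using that assms mult_right_mono[of 1 N "p + q"] by simp
    moreover have "\<gamma> \<le> 1" using that by auto
    ultimately have "p \<le> N * (p + q) - \<gamma>" using assms(2) by linarith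
    then show ?thesis using assms(1) by (simp only: f_def pos_imp_zdiv_pos_iff)
  qed
  have "i = N + boundary p q \<delta> \<epsilon> N \<longleftrightarrow> f (if i \<le> 0 then \<delta> else \<epsilon>) N = i" for N
    unfolding f using neg[of N \<delta>] neg[of N \<epsilon>] pos[of N \<delta>] pos[of N \<epsilon>] assms(3,4)
    by (cases "N \<le> 0"; cases "i \<le> 0") auto
  then show ?thesis by (simp add: christoffel_def f_def)
qed

text \<open>Passing to the index \<open>N = n - m\<close> absorbs \<open>m\<close> into the position
  shift, so both types reduce to one switch between constant offsets.\<close>

lemma cell_series_phase_change:
  assumes "p > 0" "q > 0" "\<delta> \<in> {0, 1}" "\<epsilon> \<in> {0, 1}"
    and x: "has_cell_series x B"
    and B: "\<And>n. B n = cell (nat (boundary p q \<delta> \<epsilon> (n + 1 - m) - boundary p q \<delta> \<epsilon> (n - m)))"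
  obtains t where "\<And>i. x i = (if i \<le> t then christoffel p (p + q) \<delta> (i - t)
                                       else christoffel p (p + q) \<epsilon> (i - t))"
proof -
  define g where "g n = boundary p q \<delta> \<epsilon> (n - m)" for n
  have mono: "g n \<le> g (n + 1)" for n
    using boundary_mono[OF assms(1-4), of "n - m"] by (simp add: g_def algebra_simps)
  obtain t where t: "\<And>i. x i = of_bool (\<exists>n. i = t + n + g n)"
    using has_cell_series_ones[OF x, of g] B mono by (auto simp: g_def)
  have "(\<exists>n. i = t + n + g n) \<longleftrightarrow> (\<exists>N. i - (t + m) = N + boundary p q \<delta> \<epsilon> N)" for i
  proof
    assume "\<exists>n. i = t + n + g n"
    then obtain n where "i = t + n + g n" ..
    then show "\<exists>N. i - (t + m) = N + boundary p q \<delta> \<epsilon> N"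
      by (intro exI[of _ "n - m"]) (simp add: g_def)
  next
    assume "\<exists>N. i - (t + m) = N + boundary p q \<delta> \<epsilon> N"
    then obtain N where "i - (t + m) = N + boundary p q \<delta> \<epsilon> N" ..
    then show "\<exists>n. i = t + n + g n"
      by (intro exI[of _ "N + m"]) (simp add: g_def)
  qed
  then show ?thesis
    using that[of "t + m"] t boundary_christoffel[OF assms(1-4)] by simp
qed

theorem proposition3p4:
  fixes p q a b :: int and x :: "int \<Rightarrow> nat"
  assumes "p > 0" and "q > 0" and "coprime p q"
    and "range x \<subseteq> {0, 1}"
    and "skew_sturmian x"
    and "has_frequency x (real_of_int q / real_of_int p)"
    and "0 \<le> a" and "a < q" and "0 < b" and "b \<le> p" and "b * q - a * p = 1"
  shows "(type_S x (real_of_int q / real_of_int p) \<longrightarrow>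
            eventually_periodic x \<and>
            int (eventual_least_period x) = p + q \<and>
            int (anomaly_size x) = a + b) \<and>
         (type_S' x (real_of_int q / real_of_int p) \<longrightarrow>
            eventually_periodic x \<and>
            int (eventual_least_period x) = p + q \<and>
            int (anomaly_size x) = p + q - (a + b))"
proof -
  let ?C = "christoffel p (p + q)"
  have pP: "0 < p" "p < p + q" using assms by auto
  \<comment> \<open>Adding \<open>b * p\<close> to both products turns the Bezout identity for
    \<open>(q, p)\<close> into one for \<open>(p + q, p)\<close>.\<close>
  have bc: "b * (p + q) - (a + b) * p = 1"
    using assms(11) by (simp add: algebra_simps)
  have np: "\<not> periodic x"
    using assms(5) by (simp add: skew_sturmian_def)
  have period: "(\<forall>i. ?C \<delta> (i + N - t) = ?C \<delta> (i - t)) \<longleftrightarrow> p + q dvd N" for \<delta> N t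
  proof
    assume *: "\<forall>i. ?C \<delta> (i + N - t) = ?C \<delta> (i - t)"
    have "?C \<delta> (i + N) = ?C \<delta> i" for i
      using *[rule_format, of "i + t"] by (simp add: algebra_simps)
    then show "p + q dvd N"
      using christoffel_period_iff[OF pP bc] by blast
  next
    assume "p + q dvd N"
    then have "?C \<delta> (i - t + N) = ?C \<delta> (i - t)" for i
      using christoffel_period_iff[OF pP bc] by blast
    then show "\<forall>i. ?C \<delta> (i + N - t) = ?C \<delta> (i - t)"
      by (simp add: algebra_simps)
  qed
  show ?thesis
  proof (intro conjI impI)
    assume "type_S x (real_of_int q / real_of_int p)"
    then obtain m where "has_cell_series x (S_series m (real_of_int q / real_of_int p))"
      by (auto simp: type_S_def)
    then obtain t where t: "\<And>i. x i = (if i \<le> t then ?C 0 (i - t) else ?C 1 (i - t))"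
      using cell_series_phase_change[OF assms(1,2) _ _ _ S_series_eq[OF assms(1,2)]] by blast
    have "eventually_periodic x \<and> int (eventual_least_period x) = p + q \<and>
        int (anomaly_size x) = a + b"
    proof (rule phase_change[where A = "\<lambda>i. ?C 0 (i - t)" and t = t])
      show "x i = (if i \<le> t then ?C 0 (i - t) else ?C 0 (i - (a + b) - t))" for i
        using t[of i] christoffel_translate[OF pP bc, of "i - t"] by (simp add: algebra_simps)
    \<comment> \<open>The bounds \<open>0 < a + b < p + q\<close> come from
      \<open>0 \<le> a < q\<close> and \<open>0 < b \<le> p\<close>.\<close>
    qed (use np period assms in auto)
    then show "eventually_periodic x" "int (eventual_least_period x) = p + q"
      "int (anomaly_size x) = a + b" by auto
  next
    assume "type_S' x (real_of_int q / real_of_int p)"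
    then obtain m where "has_cell_series x (S'_series m (real_of_int q / real_of_int p))"
      by (auto simp: type_S'_def)
    then obtain t where t: "\<And>i. x i = (if i \<le> t then ?C 1 (i - t) else ?C 0 (i - t))"
      using cell_series_phase_change[OF assms(1,2) _ _ _ S'_series_eq[OF assms(1,2)]] by blast
    have "eventually_periodic x \<and> int (eventual_least_period x) = p + q \<and>
        int (anomaly_size x) = p + q - (a + b)"
    proof (rule phase_change[where A = "\<lambda>i. ?C 1 (i - t)" and t = t])
      \<comment> \<open>Going from offset \<open>1\<close> to offset \<open>0\<close> is a
        translation by \<open>- (a + b)\<close>; adding the period \<open>p + q\<close> makes it
        positive.\<close>
      have "?C 1 (i - (p + q - (a + b)) - t) = ?C 0 (i - t)" for i
      proof -
        have "?C 1 (i - (p + q - (a + b)) - t) = ?C 0 (i - (p + q) - t)"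
          using christoffel_translate[OF pP bc, of "i - (p + q - (a + b)) - t"]
          by (simp add: algebra_simps)
        also have "\<dots> = ?C 0 (i - t)"
          using christoffel_period_iff[OF pP bc, of 0 "p + q"]
          by (metis diff_add_cancel diff_right_commute dvd_refl)
        finally show ?thesis .
      qed
      then show "x i = (if i \<le> t then ?C 1 (i - t) else ?C 1 (i - (p + q - (a + b)) - t))" for i
        using t[of i] by simp
    qed (use np period assms in auto)
    then show "eventually_periodic x" "int (eventual_least_period x) = p + q"
      "int (anomaly_size x) = p + q - (a + b)" by auto
  qed
qed

end
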